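(* $\displaystyle \mathrm{m}_\mathbb{D}(1+x+y)=\frac{3\sqrt{3}}{4\pi}L(\chi_{-3},2)+\frac{1}{6}- \frac{11\sqrt{3}}{16\pi}.$
   Context: For a nonzero rational function $P\in\mathbb{C}(x_1,\dots,x_n)$, the (logarithmic) areal Mahler measure is $\mathrm{m}_\mathbb{D}(P)=\frac{1}{\pi^n}\int_{\mathbb{D}^n}\log|P(x_1,\dots,x_n)|\,dA(x_1)\cdots dA(x_n)$, where $\mathbb{D}=\{x\in\mathbb{C}:|x|\le 1\}$ is the closed unit disk and $dA$ is Lebesgue (area) measure on $\mathbb{C}$. $L(\chi_{-3},s)$ is the Dirichlet $L$-function of the character $\chi_{-3}=\left(\frac{-3}{\cdot}\right)$ of conductor 3. *)

theory Defs
  imports "HOL-Analysis.Analysis"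
begin

definition chi_m3 :: "nat \<Rightarrow> real" where
  "chi_m3 n = (if n mod 3 = 1 then 1 else if n mod 3 = 2 then -1 else 0)"

text \<open>L(chi_{-3}, s) for real s > 1, as its (absolutely convergent) Dirichlet series.\<close>
definition L_chi_m3 :: "real \<Rightarrow> real" where
  "L_chi_m3 s = (\<Sum>n. chi_m3 (Suc n) / (real (Suc n)) powr s)"

definition unit_disk :: "complex set" where
  "unit_disk = cball 0 1"

text \<open>Areal Mahler measure of a function of two complex variables:
  (1/pi^2) times the integral over D x D of log|P(x,y)|, with respect to
  Lebesgue measure on C x C (= product of the area measures).\<close>
definition areal_mahler2 :: "(complex \<Rightarrow> complex \<Rightarrow> complex) \<Rightarrow> real" where
  "areal_mahler2 P = (1 / pi ^ 2) *
     (\<integral>z \<in> unit_disk \<times> unit_disk. ln (cmod (P (fst z) (snd z))) \<partial>(lborel :: (complex \<times> complex) measure))"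

end

theory Submission
  imports
    Defs
    "HOL-Complex_Analysis.Cauchy_Integral_Formula"
    "HOL-Real_Asymp.Real_Asymp"
begin

text \<open>
  For fixed \<open>x\<close>, Jensen's formula on circles shows that the mean of \<open>ln \<bar>a + y\<bar>\<close> over the unit disk,
  with \<open>a = 1 + x\<close>, is \<open>(\<bar>a\<bar>\<^sup>2 - 1) / 2\<close> if \<open>\<bar>a\<bar> \<le> 1\<close> and \<open>ln \<bar>a\<bar>\<close> otherwise. This is radial in \<open>a\<close>,
  which runs over the disk \<open>\<bar>a - 1\<bar> \<le> 1\<close>, in polar coordinates \<open>0 \<le> r \<le> 2 cos \<theta>\<close>; so the measure becomes
  a one-dimensional integral over \<open>\<theta>\<close>. It is elementary except for the integral of \<open>ln (2 cos \<theta>)\<close>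
  over \<open>\<bar>\<theta>\<bar> \<le> pi / 3\<close>, where the Fourier series \<open>\<Sum> (-1)\<^sup>n\<^sup>+\<^sup>1 cos (2 n \<theta>) / n\<close> integrates termwise to
  \<open>L(\<chi>\<^sub>-\<^sub>3, 2)\<close>, because \<open>sin (2 pi n / 3) = sqrt 3 / 2 * \<chi>\<^sub>-\<^sub>3(n)\<close>.

  Polar coordinates are signed throughout: \<open>r\<close> ranges over all reals and \<open>\<theta>\<close> over \<open>(-pi/2, pi/2)\<close>.
  They arise from Cartesian coordinates by substituting \<open>y = x * t\<close>, rescaling \<open>x\<close>, and \<open>\<theta> = arctan t\<close>.
\<close>

section \<open>Signed polar coordinates\<close>

text \<open>Both measures give every box the product of its side lengths, and this determines
  Lebesgue measure. Complex integrals can thus be split into real and imaginary parts.\<close>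

lemma lborel_complex_eq:
  "(lborel :: complex measure) = distr (lborel \<Otimes>\<^sub>M lborel) borel (\<lambda>(x, y). Complex x y)"
proof (rule lborel_eqI)
  have [measurable]: "(\<lambda>(x, y). Complex x y) \<in> borel_measurable (lborel \<Otimes>\<^sub>M lborel :: (real \<times> real) measure)"
    unfolding Complex_eq by measurable
  fix l u :: complex
  assume le: "\<And>b. b \<in> Basis \<Longrightarrow> l \<bullet> b \<le> u \<bullet> b"
  have "Re l \<le> Re u" "Im l \<le> Im u"
    using le[of 1] le[of \<i>] by (auto simp: Basis_complex_def)
  have "emeasure (distr (lborel \<Otimes>\<^sub>M lborel) borel (\<lambda>(x, y). Complex x y)) (box l u)
      = emeasure (lborel \<Otimes>\<^sub>M lborel) ({Re l<..<Re u} \<times> {Im l<..<Im u})"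
    by (subst emeasure_distr)
      (auto intro!: arg_cong2[where f = emeasure]
        simp: in_box_complex_iff space_pair_measure)
  also have "\<dots> = ennreal (Re u - Re l) * ennreal (Im u - Im l)"
    using \<open>Re l \<le> Re u\<close> \<open>Im l \<le> Im u\<close> by (subst lborel.emeasure_pair_measure_Times) auto
  also have "\<dots> = ennreal (\<Prod>b\<in>Basis. (u - l) \<bullet> b)"
    using \<open>Re l \<le> Re u\<close> \<open>Im l \<le> Im u\<close>
    by (auto simp: Basis_complex_def ennreal_mult complex_i_not_one)
  finally show "emeasure (distr (lborel \<Otimes>\<^sub>M lborel) borel (\<lambda>(x, y). Complex x y)) (box l u)
    = ennreal (\<Prod>b\<in>Basis. (u - l) \<bullet> b)" .
qed simp

text \<open>Substitution on the compact intervals \<open>{- real n..real n}\<close>, followed by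
  monotone convergence: their images under \<open>arctan\<close> exhaust the open interval.\<close>

lemma nn_integral_arctan:
  fixes g :: "real \<Rightarrow> ennreal"
  assumes [measurable]: "g \<in> borel_measurable borel"
  shows "(\<integral>\<^sup>+t. g (arctan t) * ennreal (1 / (1 + t\<^sup>2)) \<partial>lborel) =
         (\<integral>\<^sup>+\<theta>. g \<theta> * indicator {-pi/2<..<pi/2} \<theta> \<partial>lborel)"
proof -
  \<comment> \<open>Continuity from below of the measure with density \<open>f\<close>.\<close>
  have lim: "(\<integral>\<^sup>+x. f x * indicator (\<Union>n. A n) x \<partial>lborel) = (SUP n. \<integral>\<^sup>+x. f x * indicator (A n) x \<partial>lborel)"
    if [measurable]: "f \<in> borel_measurable borel" "\<And>n. A n \<in> sets borel" and "incseq A"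
    for f :: "real \<Rightarrow> ennreal" and A :: "nat \<Rightarrow> real set"
  proof -
    have "(\<integral>\<^sup>+x. f x * indicator (\<Union>n. A n) x \<partial>lborel) = emeasure (density lborel f) (\<Union>n. A n)"
      by (subst emeasure_density) auto
    also have "\<dots> = (SUP n. emeasure (density lborel f) (A n))"
      using \<open>incseq A\<close> by (intro SUP_emeasure_incseq[symmetric]) auto
    finally show ?thesis by (simp add: emeasure_density)
  qed
  have un1: "(\<Union>n. {- real n..real n}) = UNIV"
  proof -
    have "\<exists>n. x \<in> {- real n..real n}" for x
      using real_arch_simple[of "\<bar>x\<bar>"] by (auto simp: abs_le_iff minus_le_iff)
    then show ?thesis by blast
  qed
  have un2: "(\<Union>n. {arctan (- real n)..arctan (real n)}) = {-pi/2<..<pi/2}"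
  proof safe
    fix x assume x: "x \<in> {-pi/2<..<pi/2}"
    from un1 obtain n where "tan x \<in> {- real n..real n}" by blast
    then have "arctan (- real n) \<le> arctan (tan x)" "arctan (tan x) \<le> arctan (real n)"
      by (simp_all add: arctan_monotone' del: arctan_minus)
    with x show "x \<in> (\<Union>n. {arctan (- real n)..arctan (real n)})"
      by (auto simp: arctan_tan)
  next
    fix x n assume "x \<in> {arctan (- real n)..arctan (real n)}"
    then show "x \<in> {-pi/2<..<pi/2}"
      using arctan_bounded[of "real n"] arctan_bounded[of "- real n"] by auto
  qed
  have "(\<integral>\<^sup>+t. g (arctan t) * ennreal (1 / (1 + t\<^sup>2)) \<partial>lborel) =
    (SUP n. \<integral>\<^sup>+t. g (arctan t) * ennreal (1 / (1 + t\<^sup>2)) * indicator {- real n..real n} t \<partial>lborel)"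
    by (subst lim[symmetric]) (auto simp: un1 incseq_def)
  also have "\<dots> = (SUP n. \<integral>\<^sup>+x. g x * indicator {arctan (- real n)..arctan (real n)} x \<partial>lborel)"
  proof (rule SUP_cong)
    fix n :: nat
    show "(\<integral>\<^sup>+t. g (arctan t) * ennreal (1 / (1 + t\<^sup>2)) * indicator {- real n..real n} t \<partial>lborel) =
      (\<integral>\<^sup>+x. g x * indicator {arctan (- real n)..arctan (real n)} x \<partial>lborel)"
    \<comment> \<open>The substitution is made on a nondegenerate interval; for \<open>n = 0\<close>
      both intervals are the null set consisting of 0.\<close>
    proof (cases "n = 0")
      case True
      have "AE x in lborel. x \<noteq> (0::real)" by (rule AE_lborel_singleton)
      then show ?thesis using True
        by (intro nn_integral_cong_AE) (auto elim!: eventually_mono split: split_indicator)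
    next
      case False
      then show ?thesis
        by (intro nn_integral_substitution_aux[symmetric])
          (auto intro!: derivative_eq_intros continuous_intros simp: add_nonneg_eq_0_iff field_simps)
    qed
  qed simp
  also have "\<dots> = (\<integral>\<^sup>+\<theta>. g \<theta> * indicator {-pi/2<..<pi/2} \<theta> \<partial>lborel)"
    by (subst lim[symmetric]) (auto simp: un2 incseq_def arctan_monotone' intro: order_trans)
  finally show ?thesis .
qed

lemma borel_measurable_cis [measurable]: "cis \<in> borel_measurable borel"
  by (intro borel_measurable_continuous_onI continuous_intros)

text \<open>Each line through the origin except the vertical one has exactly one angle in the open
  interval, negative \<open>r\<close> being its left half. The vertical line is a null set.\<close>

lemma nn_integral_polar:
  fixes F :: "complex \<Rightarrow> ennreal"
  assumes [measurable]: "F \<in> borel_measurable borel"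
  shows "(\<integral>\<^sup>+z. F z \<partial>lborel) =
    (\<integral>\<^sup>+\<theta>. (\<integral>\<^sup>+r. ennreal \<bar>r\<bar> * F (of_real r * cis \<theta>) \<partial>lborel) * indicator {-pi/2<..<pi/2} \<theta> \<partial>lborel)"
proof -
  have [measurable]: "(\<lambda>(x, y). Complex x y) \<in> borel_measurable (borel \<Otimes>\<^sub>M borel :: (real \<times> real) measure)"
    unfolding Complex_eq by measurable
  have "(\<integral>\<^sup>+z. F z \<partial>lborel) = (\<integral>\<^sup>+p. F (Complex (fst p) (snd p)) \<partial>(lborel \<Otimes>\<^sub>M lborel))"
    by (subst lborel_complex_eq, subst nn_integral_distr) (auto simp: case_prod_beta)
  also have "\<dots> = (\<integral>\<^sup>+x. \<integral>\<^sup>+y. F (Complex x y) \<partial>lborel \<partial>lborel)"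
    by (subst lborel.nn_integral_fst[symmetric]) auto
  also have "\<dots> = (\<integral>\<^sup>+x. \<integral>\<^sup>+t. ennreal \<bar>x\<bar> * F (Complex x (x * t)) \<partial>lborel \<partial>lborel)"
  proof (rule nn_integral_cong_AE)
    have "(\<integral>\<^sup>+y. F (Complex x y) \<partial>lborel) = (\<integral>\<^sup>+t. ennreal \<bar>x\<bar> * F (Complex x (x * t)) \<partial>lborel)"
      if "x \<noteq> 0" for x
      using that by (subst nn_integral_real_affine[where c = x and t = 0])
        (auto simp: nn_integral_cmult)
    then show "AE x in lborel. (\<integral>\<^sup>+y. F (Complex x y) \<partial>lborel) = (\<integral>\<^sup>+t. ennreal \<bar>x\<bar> * F (Complex x (x * t)) \<partial>lborel)"
      using AE_lborel_singleton[of "0::real"] by auto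
  qed
  also have "\<dots> = (\<integral>\<^sup>+t. \<integral>\<^sup>+x. ennreal \<bar>x\<bar> * F (Complex x (x * t)) \<partial>lborel \<partial>lborel)"
    by (rule lborel_pair.Fubini') measurable
  also have "\<dots> = (\<integral>\<^sup>+t. (\<integral>\<^sup>+r. ennreal \<bar>r\<bar> * F (of_real r * cis (arctan t)) \<partial>lborel) * ennreal (1 / (1 + t\<^sup>2)) \<partial>lborel)"
  proof (rule nn_integral_cong)
    fix t :: real
    \<comment> \<open>\<open>c\<close> is the cosine of \<open>arctan t\<close>, so
      \<open>x = c * r\<close> makes \<open>r\<close> the signed distance from the origin. One
      factor \<open>c\<close> comes from the substitution and one from \<open>\<bar>x\<bar>\<close>;
      together they form the derivative of \<open>arctan\<close>.\<close>
    define c where "c = 1 / sqrt (1 + t\<^sup>2)"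
    have c: "c > 0" "c * c = 1 / (1 + t\<^sup>2)"
      by (auto simp: c_def add_pos_nonneg simp flip: power2_eq_square)
         (auto simp: power_divide)
    have e: "Complex (c * r) (c * r * t) = of_real r * cis (arctan t)" for r
      by (simp add: complex_eq_iff c_def cos_arctan sin_arctan)
    have "(\<integral>\<^sup>+x. ennreal \<bar>x\<bar> * F (Complex x (x * t)) \<partial>lborel)
      = ennreal c * (\<integral>\<^sup>+r. ennreal \<bar>c * r\<bar> * F (Complex (c * r) (c * r * t)) \<partial>lborel)"
      using c by (subst nn_integral_real_affine[where c = c and t = 0]) auto
    also have "\<dots> = ennreal c * (\<integral>\<^sup>+r. ennreal c * (ennreal \<bar>r\<bar> * F (of_real r * cis (arctan t))) \<partial>lborel)"
      unfolding e using c by (simp add: abs_mult ennreal_mult mult.assoc)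
    also have "\<dots> = ennreal (c * c) * (\<integral>\<^sup>+r. (ennreal \<bar>r\<bar> * F (of_real r * cis (arctan t))) \<partial>lborel)"
      using c(1) by (subst nn_integral_cmult) (simp_all add: ennreal_mult[of c c] mult.assoc)
    finally show "(\<integral>\<^sup>+x. ennreal \<bar>x\<bar> * F (Complex x (x * t)) \<partial>lborel) = 
      (\<integral>\<^sup>+r. ennreal \<bar>r\<bar> * F (of_real r * cis (arctan t)) \<partial>lborel) * ennreal (1 / (1 + t\<^sup>2))"
      by (simp add: c mult.commute)
  qed
  also have "\<dots> = (\<integral>\<^sup>+\<theta>. (\<integral>\<^sup>+r. ennreal \<bar>r\<bar> * F (of_real r * cis \<theta>) \<partial>lborel) * indicator {-pi/2<..<pi/2} \<theta> \<partial>lborel)"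
    by (rule nn_integral_arctan) measurable
  finally show ?thesis .
qed

section \<open>Jensen's formula on circles\<close>

lemma one_plus_not_nonpos_Reals:
  fixes z :: complex
  assumes "norm z < 1"
  shows "1 + z \<notin> \<real>\<^sub>\<le>\<^sub>0"
proof
  assume "1 + z \<in> \<real>\<^sub>\<le>\<^sub>0"
  then have "Re z \<le> -1" by (auto simp: complex_nonpos_Reals_iff)
  with abs_Re_le_cmod[of z] assms show False by linarith
qed

text \<open>Mean value property: \<open>Ln (1 + w * z)\<close> is holomorphic on the closed unit
  disk and vanishes at the centre, so Cauchy's formula gives circle mean 0. The claim is its real
  part.\<close>

lemma has_integral_ln_circle:
  fixes w :: complex
  assumes w: "norm w < 1"
  shows "((\<lambda>s. ln (norm (1 + w * cis (2 * pi * s)))) has_integral 0) {0..1}"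
proof -
  have wz: "norm (w * z) < 1" if "norm z \<le> 1" for z
    using that w by (simp add: norm_mult) (metis mult_left_le norm_ge_zero order_le_less_trans)
  have "(\<lambda>z. Ln (1 + w * z)) holomorphic_on cball 0 1"
    using wz by (intro holomorphic_intros one_plus_not_nonpos_Reals) auto
  then have "((\<lambda>u. Ln (1 + w * u) / (u - 0)) has_contour_integral (2 * of_real pi * \<i> * Ln (1 + w * 0))) (circlepath 0 1)"
    by (rule Cauchy_integral_circlepath_simple) auto
  then have "((\<lambda>s. Ln (1 + w * circlepath 0 1 s) / circlepath 0 1 s * vector_derivative (circlepath 0 1) (at s within {0..1})) has_integral 0) {0..1}"
    by (simp add: has_contour_integral_def)
  then have "((\<lambda>s. (2 * pi * \<i>) * Ln (1 + w * cis (2 * pi * s))) has_integral 0) {0..1}"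
    by (rule has_integral_eq[rotated])
       (auto simp: vector_derivative_circlepath01, simp add: circlepath cis_conv_exp mult_ac)
  then have "((\<lambda>s. (1 / (2 * pi * \<i>)) * ((2 * pi * \<i>) * Ln (1 + w * cis (2 * pi * s)))) has_integral ((1 / (2 * pi * \<i>)) * 0)) {0..1}"
    by (rule has_integral_mult_right)
  then have "((\<lambda>s. Ln (1 + w * cis (2 * pi * s))) has_integral 0) {0..1}"
    by (simp add: mult.assoc[symmetric])
  then have "((\<lambda>s. Re (Ln (1 + w * cis (2 * pi * s)))) has_integral Re 0) {0..1}"
    by (rule has_integral_Re)
  moreover have "Re (Ln (1 + w * cis (2 * pi * s))) = ln (norm (1 + w * cis (2 * pi * s)))" for s
    using one_plus_not_nonpos_Reals[of "w * cis (2 * pi * s)"] wz[of "cis (2 * pi * s)"] by (subst Re_Ln) auto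
  ultimately show ?thesis
    by simp
qed

text \<open>Substitute \<open>s = \<theta> / pi + 1/2\<close> in the previous lemma; the shift by
  half a turn produces the minus sign.\<close>

lemma has_integral_ln_circle_half:
  fixes w :: complex
  assumes w: "norm w < 1"
  shows "((\<lambda>\<theta>. ln (norm (1 - w * cis (2 * \<theta>)))) has_integral 0) {-pi/2..pi/2}"
proof -
  have "((\<lambda>\<theta>. ln (norm (1 + w * cis (2 * pi * ((1/pi) * \<theta> + 1/2))))) has_integral
      (1 / \<bar>1/pi\<bar> ^ DIM(real)) *\<^sub>R 0) ((\<lambda>x. (1 / (1/pi)) *\<^sub>R x + - ((1 / (1/pi)) *\<^sub>R (1/2))) ` cbox 0 1)"
    using has_integral_affinity[OF has_integral_ln_circle[OF w, folded cbox_interval], of "1/pi" "1/2"] by simp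
  moreover have "(\<lambda>x. (1 / (1/pi)) *\<^sub>R x + - ((1 / (1/pi)) *\<^sub>R (1/2))) ` cbox 0 1 = {-pi/2..pi/2}"
    using pi_gt_zero by (subst image_affinity_cbox) (auto simp: field_simps)
  moreover have "cis (2 * pi * ((1/pi) * \<theta> + 1/2)) = - cis (2 * \<theta>)" for \<theta>
    by (simp add: distrib_left flip: cis_mult)
  ultimately show ?thesis by simp
qed

text \<open>The two logarithms belong to antipodal points, whose product is \<open>a\<^sup>2 - r\<^sup>2 cis (2 \<theta>)\<close>; this makes the half circle \<open>{-pi/2..pi/2}\<close> a full turn.\<close>
lemma has_integral_ln_antipodal:
  fixes a :: complex and r :: real
  assumes r: "r \<ge> 0" and ne: "norm a \<noteq> r"
  shows "((\<lambda>\<theta>. ln (norm (a + of_real r * cis \<theta>)) + ln (norm (a - of_real r * cis \<theta>))) has_integral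
     (2 * pi * ln (max (norm a) r))) {-pi/2..pi/2}"
proof -
  define m where "m = max (norm a) r"
  have m: "m > 0" using ne r unfolding m_def using norm_ge_zero[of a] by linarith
  \<comment> \<open>The larger of the two squares is factored out; \<open>w\<close> is the quotient
    of the smaller by the larger, conjugated when \<open>r\<close> is the larger radius.\<close>
  obtain w where w: "norm w < 1" "\<And>\<theta>. norm (a\<^sup>2 - (of_real r * cis \<theta>)\<^sup>2) = m\<^sup>2 * norm (1 - w * cis (2 * \<theta>))"
  proof (cases "r < norm a")
    case True
    have "norm ((of_real r)\<^sup>2 / a\<^sup>2) < 1"
      using True r by (auto simp: norm_divide norm_power power_strict_mono divide_less_eq)
    moreover have "norm (a\<^sup>2 - (of_real r * cis \<theta>)\<^sup>2) = m\<^sup>2 * norm (1 - (of_real r)\<^sup>2 / a\<^sup>2 * cis (2 * \<theta>))" for \<theta>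
    proof -
      have "a\<^sup>2 - (of_real r * cis \<theta>)\<^sup>2 = a\<^sup>2 * (1 - (of_real r)\<^sup>2 / a\<^sup>2 * cis (2 * \<theta>))"
        using True r by (auto simp: field_simps power_mult_distrib Complex.DeMoivre)
      then show ?thesis using True by (simp add: norm_mult norm_power m_def)
    qed
    ultimately show ?thesis by (rule that)
  next
    case False
    with ne have lt: "norm a < r" by simp
    with r have "r > 0" using norm_ge_zero[of a] by linarith
    have "norm (cnj (a\<^sup>2 / (of_real r)\<^sup>2)) < 1"
      using lt r by (auto simp: norm_divide norm_power power_strict_mono divide_less_eq)
    moreover have "norm (a\<^sup>2 - (of_real r * cis \<theta>)\<^sup>2) = m\<^sup>2 * norm (1 - cnj (a\<^sup>2 / (of_real r)\<^sup>2) * cis (2 * \<theta>))" for \<theta>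
    proof -
      have "a\<^sup>2 - (of_real r * cis \<theta>)\<^sup>2 = - ((of_real r)\<^sup>2 * cis (2 * \<theta>)) * (1 - a\<^sup>2 / (of_real r)\<^sup>2 * cis (- (2 * \<theta>)))"
        using \<open>r > 0\<close> by (simp add: field_simps power_mult_distrib Complex.DeMoivre cis_mult)
      also have "norm \<dots> = m\<^sup>2 * norm (1 - a\<^sup>2 / (of_real r)\<^sup>2 * cis (- (2 * \<theta>)))"
        using lt by (simp add: norm_mult norm_power m_def)
      \<comment> \<open>Conjugation keeps the norm and reverses the angle, which brings the factor
        into the form of \<open>has_integral_ln_circle_half\<close>.\<close>
      also have "norm (1 - a\<^sup>2 / (of_real r)\<^sup>2 * cis (- (2 * \<theta>))) = norm (cnj (1 - a\<^sup>2 / (of_real r)\<^sup>2 * cis (- (2 * \<theta>))))"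
        by (simp only: complex_mod_cnj)
      finally show ?thesis by (simp add: cis_cnj)
    qed
    ultimately show ?thesis by (rule that)
  qed
  have ne0: "a + of_real r * cis \<theta> \<noteq> 0" "a - of_real r * cis \<theta> \<noteq> 0" for \<theta>
  proof -
    have "norm (of_real r * cis \<theta>) = r" using r by (simp add: norm_mult)
    with ne show "a + of_real r * cis \<theta> \<noteq> 0" "a - of_real r * cis \<theta> \<noteq> 0"
      by (metis add_eq_0_iff norm_minus_cancel, metis eq_iff_diff_eq_0)
  qed
  have "((\<lambda>\<theta>. 2 * ln m + ln (norm (1 - w * cis (2 * \<theta>)))) has_integral (2 * ln m * pi + 0)) {-pi/2..pi/2}"
    using has_integral_const_real[of "2 * ln m" "-pi/2" "pi/2"]
    by (intro has_integral_add has_integral_ln_circle_half w) (simp add: mult_ac)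
  moreover have "2 * ln m + ln (norm (1 - w * cis (2 * \<theta>))) =
     ln (norm (a + of_real r * cis \<theta>)) + ln (norm (a - of_real r * cis \<theta>))" for \<theta>
  proof -
    have nz: "norm (a\<^sup>2 - (of_real r * cis \<theta>)\<^sup>2) \<noteq> 0"
      using ne0[of \<theta>] by (simp add: power2_eq_square square_diff_square_factored)
    then have "1 - w * cis (2 * \<theta>) \<noteq> 0"
      unfolding w by auto
    have "ln (norm (a + of_real r * cis \<theta>)) + ln (norm (a - of_real r * cis \<theta>)) = ln (norm (a\<^sup>2 - (of_real r * cis \<theta>)\<^sup>2))"
      using ne0[of \<theta>] by (simp add: power2_eq_square square_diff_square_factored norm_mult ln_mult)
    also have "\<dots> = 2 * ln m + ln (norm (1 - w * cis (2 * \<theta>)))"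
      unfolding w using m \<open>1 - w * cis (2 * \<theta>) \<noteq> 0\<close>
      by (subst ln_mult) (auto simp: ln_realpow)
    finally show ?thesis by simp
  qed
  ultimately show ?thesis by (simp add: m_def mult_ac)
qed

section \<open>Elementary one-dimensional integrals\<close>

text \<open>The mean of \<open>ln (norm (a + y))\<close> over the unit disk in \<open>y\<close>, as
  a function of \<open>s = norm a\<close>; justified by \<open>nn_integral_disk_ln\<close>.\<close>

definition disk_log_mean :: "real \<Rightarrow> real" where
  "disk_log_mean s = (if s \<le> 1 then (s\<^sup>2 - 1) / 2 else ln s)"

text \<open>The point of interest is 0, which is an endpoint of the radial integral below when
  \<open>s = 0\<close>.\<close>

lemma continuous_on_square_mult_ln:
  "continuous_on {0..} (\<lambda>x::real. x\<^sup>2 * ln x)"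
  unfolding continuous_on_def
proof
  fix x :: real
  assume "x \<in> {0..}"
  then consider "x = 0" | "x > 0" by fastforce
  then show "((\<lambda>x. x\<^sup>2 * ln x) \<longlongrightarrow> x\<^sup>2 * ln x) (at x within {0..})"
  proof cases
    case 1
    have "((\<lambda>x::real. x\<^sup>2 * ln x) \<longlongrightarrow> 0) (at_right 0)" by real_asymp
    with 1 show ?thesis by (simp add: at_within_Ici_at_right)
  next
    case 2
    then show ?thesis by (intro tendsto_intros) auto
  qed
qed

text \<open>\<open>ln (max s r)\<close> is the mean over the circle of radius \<open>r\<close>.
  Integrated against \<open>r\<close> it yields half the disk mean, since \<open>r\<close> itself
  has integral 1/2. The integral is split at \<open>s\<close> when \<open>s < 1\<close>; the
  constant \<open>c\<close> will be \<open>ln 4\<close>.\<close>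

lemma has_integral_radial_ln_max:
  fixes s c :: real
  assumes "s \<ge> 0"
  shows "((\<lambda>r. r * (c - ln (max s r))) has_integral (c - disk_log_mean s) / 2) {0..1}"
proof -
  have const: "((\<lambda>r. r * (c - ln (max s r))) has_integral (b\<^sup>2 / 2 * (c - ln s))) {0..b}" if "0 \<le> b" "b \<le> s" for b
  proof -
    have "((\<lambda>r. r * (c - ln s)) has_integral (b\<^sup>2 / 2 * (c - ln s) - 0\<^sup>2 / 2 * (c - ln s))) {0..b}"
      using that by (intro fundamental_theorem_of_calculus)
        (auto intro!: derivative_eq_intros simp: has_real_derivative_iff_has_vector_derivative[symmetric])
    then have "((\<lambda>r. r * (c - ln (max s r))) has_integral (b\<^sup>2 / 2 * (c - ln s) - 0\<^sup>2 / 2 * (c - ln s))) {0..b}"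
      by (rule has_integral_eq[rotated]) (use that in \<open>simp add: max_absorb1\<close>)
    then show ?thesis by simp
  qed
  show ?thesis
  proof (cases "s < 1")
    case False
    then have "disk_log_mean s = ln s" by (cases "s = 1") (auto simp: disk_log_mean_def)
    with const[of 1] False show ?thesis by simp
  next
    case True
    let ?F = "\<lambda>r. r\<^sup>2 / 2 * c + r\<^sup>2 / 4 - (r\<^sup>2 * ln r) / 2"
    have "((\<lambda>r. r * (c - ln r)) has_integral (?F 1 - ?F s)) {s..1}"
    proof (rule fundamental_theorem_of_calculus_interior)
      show "continuous_on {s..1} ?F"
        using assms by (intro continuous_intros continuous_on_subset[OF continuous_on_square_mult_ln]) auto
      fix x assume "x \<in> {s<..<1}"
      then have "x > 0" using assms by auto
      then show "(?F has_vector_derivative x * (c - ln x)) (at x)"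
        unfolding has_real_derivative_iff_has_vector_derivative[symmetric]
        by (auto intro!: derivative_eq_intros simp: field_simps power2_eq_square)
    qed (use True in simp)
    then have "((\<lambda>r. r * (c - ln (max s r))) has_integral (?F 1 - ?F s)) {s..1}"
      by (rule has_integral_eq[rotated]) (simp add: max_absorb2)
    then have "((\<lambda>r. r * (c - ln (max s r))) has_integral (s\<^sup>2 / 2 * (c - ln s) + (?F 1 - ?F s))) {0..1}"
      using True assms by (intro has_integral_combine[OF _ _ const[of s]]) auto
    then show ?thesis
      by (rule has_integral_eq_rhs) (use True in \<open>simp add: disk_log_mean_def field_simps\<close>)
  qed
qed

text \<open>The integral of \<open>r * disk_log_mean r\<close> over \<open>{0..R}\<close>, in closed
  form. The constant 1/8 makes the two branches agree at \<open>R = 1\<close>.\<close>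

definition radial_log_mean :: "real \<Rightarrow> real" where
  "radial_log_mean R = (if R \<le> 1 then R ^ 4 / 8 - R\<^sup>2 / 4 else 1 / 8 + R\<^sup>2 / 2 * ln R - R\<^sup>2 / 4)"

lemma has_integral_radial_disk_log_mean:
  fixes R c :: real
  assumes "R \<ge> 0"
  shows "((\<lambda>r. r * (c - disk_log_mean r)) has_integral (c * R\<^sup>2 / 2 - radial_log_mean R)) {0..R}"
proof -
  have inner: "((\<lambda>r. r * (c - disk_log_mean r)) has_integral (c * b\<^sup>2 / 2 - radial_log_mean b)) {0..b}" if "0 \<le> b" "b \<le> 1" for b
  proof -
    let ?F = "\<lambda>b. c * b\<^sup>2 / 2 - (b ^ 4 / 8 - b\<^sup>2 / 4)"
    have "((\<lambda>r. r * (c - (r\<^sup>2 - 1) / 2)) has_integral (?F b - ?F 0)) {0..b}"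
      using that by (intro fundamental_theorem_of_calculus)
        (auto intro!: derivative_eq_intros simp: field_simps power2_eq_square power3_eq_cube has_real_derivative_iff_has_vector_derivative[symmetric])
    then have "((\<lambda>r. r * (c - disk_log_mean r)) has_integral (?F b - ?F 0)) {0..b}"
      by (rule has_integral_eq[rotated]) (use that in \<open>auto simp: disk_log_mean_def\<close>)
    then show ?thesis
      using that by (simp add: radial_log_mean_def)
  qed
  show ?thesis
  proof (cases "R \<le> 1")
    case True
    then show ?thesis using inner assms by auto
  next
    case False
    let ?F = "\<lambda>r. c * r\<^sup>2 / 2 - (1 / 8 + r\<^sup>2 / 2 * ln r - r\<^sup>2 / 4)"
    have "((\<lambda>r. r * (c - ln r)) has_integral (?F R - ?F 1)) {1..R}"
      using False by (intro fundamental_theorem_of_calculus)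
        (auto intro!: derivative_eq_intros simp: field_simps power2_eq_square has_real_derivative_iff_has_vector_derivative[symmetric])
    then have "((\<lambda>r. r * (c - disk_log_mean r)) has_integral (?F R - ?F 1)) {1..R}"
      by (rule has_integral_eq[rotated]) (auto simp: disk_log_mean_def)
    then have "((\<lambda>r. r * (c - disk_log_mean r)) has_integral (c * 1\<^sup>2 / 2 - radial_log_mean 1 + (?F R - ?F 1))) {0..R}"
      using False by (intro has_integral_combine[OF _ _ inner[of 1]]) auto
    then show ?thesis
      by (rule has_integral_eq_rhs) (use False in \<open>simp add: radial_log_mean_def\<close>)
  qed
qed

lemma has_integral_cos_square:
  fixes a b :: real
  assumes "a \<le> b"
  shows "((\<lambda>\<theta>. (cos \<theta>)\<^sup>2) has_integral ((b - a) / 2 + (sin (2 * b) - sin (2 * a)) / 4)) {a..b}"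
proof -
  let ?F = "\<lambda>\<theta>::real. \<theta> / 2 + sin (2 * \<theta>) / 4"
  have c2: "(cos \<theta>)\<^sup>2 = (1 + cos (\<theta> * 2)) / 2" for \<theta> :: real
    using cos_double_cos[of \<theta>] by (simp add: mult.commute)
  have "((\<lambda>\<theta>. (cos \<theta>)\<^sup>2) has_integral (?F b - ?F a)) {a..b}"
    using assms by (intro fundamental_theorem_of_calculus)
      (auto intro!: derivative_eq_intros simp: c2 field_simps has_real_derivative_iff_has_vector_derivative[symmetric])
  then show ?thesis by (rule has_integral_eq_rhs) (simp add: field_simps)
qed

lemma has_integral_cos_power4:
  fixes a b :: real
  assumes "a \<le> b"
  shows "((\<lambda>\<theta>. cos \<theta> ^ 4) has_integral (3 * (b - a) / 8 + (sin (2 * b) - sin (2 * a)) / 4 + (sin (4 * b) - sin (4 * a)) / 32)) {a..b}"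
proof -
  let ?F = "\<lambda>\<theta>::real. 3 * \<theta> / 8 + sin (2 * \<theta>) / 4 + sin (4 * \<theta>) / 32"
  have c4: "cos (4 * \<theta>) = 8 * cos \<theta> ^ 4 - 8 * (cos \<theta>)\<^sup>2 + 1" for \<theta> :: real
  proof -
    have "cos (4 * \<theta>) = 2 * (cos (2 * \<theta>))\<^sup>2 - 1"
      using cos_double_cos[of "2 * \<theta>"] by simp
    then show ?thesis
      unfolding cos_double_cos by (simp add: power2_eq_square power4_eq_xxxx algebra_simps)
  qed
  have c4': "cos \<theta> ^ 4 = (3 + 4 * cos (\<theta> * 2) + cos (\<theta> * 4)) / 8" for \<theta> :: real
    using c4[of \<theta>] cos_double_cos[of \<theta>] by (simp add: mult.commute)
  have "((\<lambda>\<theta>. cos \<theta> ^ 4) has_integral (?F b - ?F a)) {a..b}"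
    using assms by (intro fundamental_theorem_of_calculus)
      (auto intro!: derivative_eq_intros simp: c4' field_simps has_real_derivative_iff_has_vector_derivative[symmetric])
  then show ?thesis by (rule has_integral_eq_rhs) (simp add: field_simps)
qed

lemma sin_pi_thirds: "sin (pi * 2 / 3) = sqrt 3 / 2" "sin (pi * 4 / 3) = - sqrt 3 / 2"
  using sin_60 sin_pi_minus[of "pi/3"] sin_periodic_pi[of "pi/3"] by (simp_all add: field_simps)

text \<open>Integration by parts; the logarithm vanishes at both endpoints. This is the elementary
  part of the integral of \<open>2 * (cos \<theta>)\<^sup>2 * ln (2 * cos \<theta>)\<close>, whose
  first factor is \<open>1 + cos (2 * \<theta>)\<close>.\<close>

lemma has_integral_cos_double_ln:
  "((\<lambda>\<theta>. cos (2 * \<theta>) * ln (2 * cos \<theta>)) has_integral (pi / 3 - sqrt 3 / 4)) {-pi/3..pi/3}"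
proof -
  let ?F = "\<lambda>\<theta>::real. sin (2 * \<theta>) / 2 * ln (2 * cos \<theta>) + \<theta> / 2 - sin (2 * \<theta>) / 4"
  have "((\<lambda>\<theta>. cos (2 * \<theta>) * ln (2 * cos \<theta>)) has_integral (?F (pi/3) - ?F (-pi/3))) {-pi/3..pi/3}"
  proof (rule fundamental_theorem_of_calculus)
    fix \<theta> assume "\<theta> \<in> {-pi/3..pi/3}"
    then have "cos \<theta> > 0"
      using pi_gt_zero unfolding atLeastAtMost_iff by (intro cos_gt_zero_pi) linarith+
    \<comment> \<open>Divided by \<open>cos \<theta>\<close>, this identity cancels the term from
      differentiating the logarithm against the derivatives of the two elementary summands.\<close>
    moreover have "cos \<theta> = cos \<theta> * cos (\<theta> * 2) + sin \<theta> * sin (\<theta> * 2)"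
      using cos_diff[of "\<theta> * 2" \<theta>] by (simp add: mult.commute)
    ultimately show "(?F has_vector_derivative cos (2 * \<theta>) * ln (2 * cos \<theta>)) (at \<theta> within {-pi/3..pi/3})"
      unfolding has_real_derivative_iff_has_vector_derivative[symmetric]
      by (auto intro!: derivative_eq_intros simp: field_simps)
  qed simp
  then show ?thesis
    by (rule has_integral_eq_rhs) (simp add: cos_60 sin_pi_thirds field_simps)
qed

text \<open>The radius \<open>2 * cos \<theta>\<close> crosses 1 at
  \<open>\<theta> = \<plusminus> pi / 3\<close>, so the range is cut there. The outer pieces involve
  only powers of the cosine; in the middle piece \<open>I\<close> is the one term without an
  elementary antiderivative.\<close>

lemma has_integral_radial_log_mean:
  fixes c I :: real
  assumes I: "((\<lambda>\<theta>. ln (2 * cos \<theta>)) has_integral I) {-pi/3..pi/3}"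
  shows "((\<lambda>\<theta>. c * (2 * cos \<theta>)\<^sup>2 / 2 - radial_log_mean (2 * cos \<theta>)) has_integral
    (c * pi - pi / 6 + 11 * sqrt 3 / 16 - I)) {-pi/2..pi/2}"
proof -
  let ?f = "\<lambda>\<theta>. c * (2 * cos \<theta>)\<^sup>2 / 2 - radial_log_mean (2 * cos \<theta>)"
  let ?g = "\<lambda>\<theta>. (2 * c + 1) * (cos \<theta>)\<^sup>2 - 2 * cos \<theta> ^ 4"
  have outer: "(?f has_integral ((2 * c + 1) * ((b - a) / 2 + (sin (2 * b) - sin (2 * a)) / 4)
        - 2 * (3 * (b - a) / 8 + (sin (2 * b) - sin (2 * a)) / 4 + (sin (4 * b) - sin (4 * a)) / 32))) {a..b}"
    if "a \<le> b" "\<And>\<theta>. \<theta> \<in> {a..b} \<Longrightarrow> cos \<theta> \<le> 1/2" for a b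
  proof (rule has_integral_eq[rotated])
    show "(?g has_integral ((2 * c + 1) * ((b - a) / 2 + (sin (2 * b) - sin (2 * a)) / 4)
        - 2 * (3 * (b - a) / 8 + (sin (2 * b) - sin (2 * a)) / 4 + (sin (4 * b) - sin (4 * a)) / 32))) {a..b}"
      using that(1) by (intro has_integral_diff has_integral_mult_right has_integral_cos_square has_integral_cos_power4)
    show "?g \<theta> = ?f \<theta>" if "\<theta> \<in> {a..b}" for \<theta>
      using \<open>\<And>\<theta>. \<theta> \<in> {a..b} \<Longrightarrow> cos \<theta> \<le> 1/2\<close>[OF that]
      by (simp add: radial_log_mean_def power_mult_distrib field_simps)
  qed
  have "cos \<theta> \<le> 1/2" if "\<theta> \<in> {pi/3..pi/2}" for \<theta>
  proof -
    have "cos \<theta> \<le> cos (pi/3)" using that pi_gt_zero unfolding atLeastAtMost_iff by (intro cos_monotone_0_pi_le) linarith+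
    then show ?thesis by (simp add: cos_60)
  qed
  note cos_le = this
  have right: "(?f has_integral ((2 * c + 1) * (pi / 12 - sqrt 3 / 8) - (pi / 8 - 7 * sqrt 3 / 32))) {pi/3..pi/2}"
    by (rule has_integral_eq_rhs[OF outer[OF _ cos_le]]) (simp_all add: sin_pi_thirds field_simps)
  have left: "(?f has_integral ((2 * c + 1) * (pi / 12 - sqrt 3 / 8) - (pi / 8 - 7 * sqrt 3 / 32))) {-pi/2..-pi/3}"
    using has_integral_reflect_real[of ?f _ "pi/2" "pi/3"] right by simp
  have mid: "(?f has_integral ((2 * c + 1) * (pi / 3 + sqrt 3 / 4) - 1 / 8 * (2 * pi / 3) - (I + (pi / 3 - sqrt 3 / 4)))) {-pi/3..pi/3}"
  proof (rule has_integral_eq[rotated])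
    have "((\<lambda>\<theta>. (cos \<theta>)\<^sup>2) has_integral (pi / 3 + sqrt 3 / 4)) {-pi/3..pi/3}"
      using has_integral_cos_square[of "-pi/3" "pi/3"] by (simp add: sin_pi_thirds field_simps)
    moreover have "((\<lambda>\<theta>. 1 / 8) has_integral (1 / 8 * (2 * pi / 3))) {-pi/3..pi/3}"
      using has_integral_const_real[of "1/8::real" "-pi/3" "pi/3"] by (simp add: field_simps)
    ultimately show "((\<lambda>\<theta>. (2 * c + 1) * (cos \<theta>)\<^sup>2 - 1 / 8 - (ln (2 * cos \<theta>) + cos (2 * \<theta>) * ln (2 * cos \<theta>))) has_integral
       ((2 * c + 1) * (pi / 3 + sqrt 3 / 4) - 1 / 8 * (2 * pi / 3) - (I + (pi / 3 - sqrt 3 / 4)))) {-pi/3..pi/3}"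
      by (intro has_integral_diff has_integral_add has_integral_mult_right I has_integral_cos_double_ln)
    show "(2 * c + 1) * (cos \<theta>)\<^sup>2 - 1 / 8 - (ln (2 * cos \<theta>) + cos (2 * \<theta>) * ln (2 * cos \<theta>)) = ?f \<theta>" if "\<theta> \<in> {-pi/3..pi/3}" for \<theta>
    proof -
      have "cos (pi/3) \<le> cos \<bar>\<theta>\<bar>"
        using that pi_gt_zero unfolding atLeastAtMost_iff by (intro cos_monotone_0_pi_le) linarith+
      then have "1 \<le> 2 * cos \<theta>" by (simp add: cos_60)
      moreover have "radial_log_mean (2 * cos \<theta>) = 1 / 8 + 2 * (cos \<theta>)\<^sup>2 * ln (2 * cos \<theta>) - (cos \<theta>)\<^sup>2" if "1 \<le> 2 * cos \<theta>"
      \<comment> \<open>At radius 1 the definition takes its polynomial branch, which has the same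
        value.\<close>
      proof (cases "2 * cos \<theta> = 1")
        case True
        then have "cos \<theta> = 1/2" by (simp add: field_simps)
        show ?thesis unfolding \<open>cos \<theta> = 1/2\<close> by (simp add: radial_log_mean_def power2_eq_square power4_eq_xxxx)
      qed (use that in \<open>simp add: radial_log_mean_def power_mult_distrib\<close>)
      ultimately show ?thesis
        unfolding cos_double_cos by (simp add: power_mult_distrib algebra_simps)
    qed
  qed
  have "- pi / 2 \<le> - pi / 3" "- pi / 3 \<le> pi / 3" "- pi / 2 \<le> pi / 3" "pi / 3 \<le> pi / 2"
    using pi_gt_zero by linarith+
  from has_integral_combine[OF \<open>- pi / 2 \<le> pi / 3\<close> \<open>pi / 3 \<le> pi / 2\<close> has_integral_combine[OF \<open>- pi / 2 \<le> - pi / 3\<close> \<open>- pi / 3 \<le> pi / 3\<close> left mid] right]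
  show ?thesis by (rule has_integral_eq_rhs) (simp add: field_simps)
qed

section \<open>The integral of the log-cosine\<close>

text \<open>Multiplicativity of the character, with value -1 at 2; it isolates the even terms of the
  series below.\<close>

lemma chi_m3_double: "chi_m3 (2 * n) = - chi_m3 n"
proof -
  have "n mod 3 = 0 \<and> 2 * n mod 3 = 0 \<or> n mod 3 = 1 \<and> 2 * n mod 3 = 2 \<or> n mod 3 = 2 \<and> 2 * n mod 3 = 1"
    by presburger
  then show ?thesis
    by (auto simp: chi_m3_def)
qed

lemma sin_two_pi_thirds: "sin (real n * (2 * pi / 3)) = sqrt 3 / 2 * chi_m3 n"
proof -
  have s: "sin (2 * pi / 3) = sqrt 3 / 2" "sin (4 * pi / 3) = - sqrt 3 / 2"
    using sin_pi_thirds by (simp_all only: mult.commute)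
  define q r where "q = n div 3" and "r = n mod 3"
  have n: "n = 3 * q + r" and r: "r = 0 \<or> r = 1 \<or> r = 2" by (auto simp: q_def r_def)
  have "real n * (2 * pi / 3) = real r * (2 * pi / 3) + 2 * real q * pi"
    by (simp add: n field_simps)
  then have "sin (real n * (2 * pi / 3)) = sin (real r * (2 * pi / 3))"
    by (simp only: sin_add sin_2npi cos_2npi mult_1_right mult_zero_right add_0_right)
  then show ?thesis using r s by (auto simp: chi_m3_def r_def[symmetric])
qed

lemma abs_chi_m3_le_1: "\<bar>chi_m3 n\<bar> \<le> 1"
  by (simp add: chi_m3_def)

lemma summable_chi_m3_over_square: "summable (\<lambda>n. \<bar>chi_m3 n / real n ^ 2\<bar>)"
  by (rule summable_comparison_test'[OF inverse_power_summable[of 2, where 'a = real], of 0])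
     (auto simp: abs_chi_m3_le_1 divide_simps)

text \<open>Since \<open>chi_m3 0 = 0\<close>, the series can start at 0, which suits the power
  series below.\<close>

lemma sums_L_chi_m3_2: "(\<lambda>n. chi_m3 n / real n ^ 2) sums L_chi_m3 2"
proof -
  have "summable (\<lambda>n. chi_m3 n / real n ^ 2)"
    using summable_chi_m3_over_square by (rule summable_rabs_cancel)
  then have "(\<lambda>n. chi_m3 (Suc n) / real (Suc n) ^ 2) sums (\<Sum>n. chi_m3 (Suc n) / real (Suc n) ^ 2)"
    by (intro summable_sums) (subst summable_Suc_iff)
  moreover have "real (Suc n) powr 2 = real (Suc n) ^ 2" for n
    by (subst powr_numeral) auto
  ultimately have "(\<lambda>n. chi_m3 (Suc n) / real (Suc n) ^ 2) sums L_chi_m3 2"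
    by (simp add: L_chi_m3_def)
  then show ?thesis
    by (subst (asm) sums_Suc_iff) (simp add: chi_m3_def)
qed

text \<open>By \<open>chi_m3_double\<close> the even terms sum to -1/4 of the whole. The alternating
  series is the whole minus twice the even part, which gives the factor 1 + 1/2.\<close>

lemma sums_alternating_chi_m3: "(\<lambda>n. (-1) ^ Suc n * chi_m3 n / real n ^ 2) sums (3 / 2 * L_chi_m3 2)"
proof -
  let ?a = "\<lambda>n. chi_m3 n / real n ^ 2"
  have "(\<lambda>n. - 1 / 4 * ?a n) sums (- 1 / 4 * L_chi_m3 2)"
    by (intro sums_mult sums_L_chi_m3_2)
  also have "(\<lambda>n. - 1 / 4 * ?a n) = (\<lambda>n. (\<lambda>k. if even k then ?a k else 0) (2 * n))"
    by (simp add: fun_eq_iff chi_m3_double power_mult_distrib)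
  finally have "(\<lambda>k. if even k then ?a k else 0) sums (- 1 / 4 * L_chi_m3 2)"
    by (subst (asm) sums_mono_reindex) (auto simp: strict_mono_def elim!: evenE)
  from sums_diff[OF sums_L_chi_m3_2 sums_mult[OF this, of 2]]
  have "(\<lambda>k. ?a k - 2 * (if even k then ?a k else 0)) sums (L_chi_m3 2 - 2 * (- 1 / 4 * L_chi_m3 2))" .
  also have "(\<lambda>k. ?a k - 2 * (if even k then ?a k else 0)) = (\<lambda>n. (-1) ^ Suc n * chi_m3 n / real n ^ 2)"
    by (auto simp: fun_eq_iff)
  finally show ?thesis by simp
qed

text \<open>The real part of the series of \<open>Ln (1 + z)\<close> at
  \<open>z = \<rho> * cis (2 * \<theta>)\<close>, integrated termwise. For \<open>\<rho> < 1\<close>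
  the terms are dominated by a geometric series, uniformly in \<open>\<theta>\<close>.\<close>

lemma integral_ln_one_plus_rho_cis:
  fixes \<rho> :: real
  assumes \<rho>: "0 \<le> \<rho>" "\<rho> < 1"
  shows "(\<lambda>n. \<rho> ^ n * (sqrt 3 / 2 * ((-1) ^ Suc n * chi_m3 n / real n ^ 2))) sums
    integral {-pi/3..pi/3} (\<lambda>\<theta>. ln (norm (1 + of_real \<rho> * cis (2 * \<theta>))))"
proof -
  let ?f = "\<lambda>n \<theta>. (-1) ^ Suc n / real n * \<rho> ^ n * cos (real n * (2 * \<theta>))"
  have sums: "(\<lambda>n. ?f n \<theta>) sums ln (norm (1 + of_real \<rho> * cis (2 * \<theta>)))" for \<theta>
  proof -
    have n1: "norm (of_real \<rho> * cis (2 * \<theta>)) < 1" using \<rho> by (simp add: norm_mult)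
    then have "1 + of_real \<rho> * cis (2 * \<theta>) \<noteq> 0"
      by (auto simp: add_eq_0_iff)
    then have "Re (Ln (1 + of_real \<rho> * cis (2 * \<theta>))) = ln (norm (1 + of_real \<rho> * cis (2 * \<theta>)))"
      by simp
    moreover have "(\<lambda>n. Re ((-1) ^ Suc n / of_nat n * (of_real \<rho> * cis (2 * \<theta>)) ^ n)) sums Re (Ln (1 + of_real \<rho> * cis (2 * \<theta>)))"
      by (intro sums_Re Ln_series n1)
    moreover have "Re ((-1) ^ Suc n / of_nat n * (of_real \<rho> * cis (2 * \<theta>)) ^ n) = ?f n \<theta>" for n
    proof -
      have "(-1) ^ Suc n / of_nat n * (of_real \<rho> * cis (2 * \<theta>)) ^ n = of_real ((-1) ^ Suc n / real n * \<rho> ^ n) * cis (real n * (2 * \<theta>))"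
        by (simp add: power_mult_distrib Complex.DeMoivre)
      then show ?thesis by (simp only: times_complex.sel Re_complex_of_real Im_complex_of_real cis.sel mult_zero_left diff_zero)
    qed
    ultimately show ?thesis by (simp only:)
  qed
  have "uniform_limit {-pi/3..pi/3} (\<lambda>N \<theta>. \<Sum>n<N. ?f n \<theta>) (\<lambda>\<theta>. \<Sum>n. ?f n \<theta>) sequentially"
  proof (rule Weierstrass_m_test)
    show "summable (\<lambda>n. \<rho> ^ n)" using \<rho> by (simp add: summable_geometric)
    fix n \<theta>
    have "\<bar>cos (real n * (2 * \<theta>))\<bar> \<le> 1" by simp
    moreover have "1 / real n \<le> 1" by (cases n) auto
    ultimately have "1 / real n * \<rho> ^ n * \<bar>cos (real n * (2 * \<theta>))\<bar> \<le> 1 * \<rho> ^ n * 1"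
      using \<rho> by (intro mult_mono) auto
    then show "norm (?f n \<theta>) \<le> \<rho> ^ n"
      using \<rho> by (simp add: abs_mult power_abs)
  qed
  moreover have "(\<lambda>\<theta>. \<Sum>n. ?f n \<theta>) = (\<lambda>\<theta>. ln (norm (1 + of_real \<rho> * cis (2 * \<theta>))))"
    using sums by (simp add: sums_iff)
  ultimately have ul: "uniform_limit {-pi/3..pi/3} (\<lambda>N \<theta>. \<Sum>n<N. ?f n \<theta>) (\<lambda>\<theta>. ln (norm (1 + of_real \<rho> * cis (2 * \<theta>)))) sequentially"
    by (simp only:)
  obtain I J where IJ:
    "\<And>N. ((\<lambda>\<theta>. \<Sum>n<N. ?f n \<theta>) has_integral I N) {-pi/3..pi/3}"
    "((\<lambda>\<theta>. ln (norm (1 + of_real \<rho> * cis (2 * \<theta>)))) has_integral J) {-pi/3..pi/3}"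
    "I \<longlonglongrightarrow> J"
    by (rule uniform_limit_integral[OF ul]) (intro continuous_intros, simp, rule that)
  have "(?f n has_integral \<rho> ^ n * (sqrt 3 / 2 * ((-1) ^ Suc n * chi_m3 n / real n ^ 2))) {-pi/3..pi/3}" for n
  \<comment> \<open>The term for \<open>n = 0\<close> is zero on both sides because division by zero
    yields 0.\<close>
  proof (cases "n = 0")
    case False
    let ?F = "\<lambda>\<theta>. (-1) ^ Suc n / real n * \<rho> ^ n * (sin (real n * (2 * \<theta>)) / (2 * real n))"
    have "(?f n has_integral ?F (pi/3) - ?F (-pi/3)) {-pi/3..pi/3}"
      using False by (intro fundamental_theorem_of_calculus)
        (auto intro!: derivative_eq_intros simp: has_real_derivative_iff_has_vector_derivative[symmetric])
    also have "?F (pi/3) - ?F (-pi/3) = (-1) ^ Suc n / real n * \<rho> ^ n * (sin (real n * (2 * pi / 3)) / real n)"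
      using False by (simp add: field_simps)
    also have "(-1) ^ Suc n / real n * \<rho> ^ n * (sin (real n * (2 * pi / 3)) / real n)
      = \<rho> ^ n * (sqrt 3 / 2 * ((-1) ^ Suc n * chi_m3 n / real n ^ 2))"
      unfolding sin_two_pi_thirds by (simp add: power2_eq_square mult_ac)
    finally show ?thesis .
  qed simp
  then have "((\<lambda>\<theta>. \<Sum>n<N. ?f n \<theta>) has_integral
      (\<Sum>n<N. \<rho> ^ n * (sqrt 3 / 2 * ((-1) ^ Suc n * chi_m3 n / real n ^ 2)))) {-pi/3..pi/3}" for N
    by (intro has_integral_sum finite_lessThan)
  then have "I = (\<lambda>N. \<Sum>n<N. \<rho> ^ n * (sqrt 3 / 2 * ((-1) ^ Suc n * chi_m3 n / real n ^ 2)))"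
    by (intro ext has_integral_unique[OF IJ(1)])
  with IJ show ?thesis by (simp add: sums_def integral_unique)
qed

text \<open>Abel summation: let \<open>\<rho>\<close> tend to 1 on both sides.\<close>
lemma has_integral_ln_2_cos:
  "((\<lambda>\<theta>. ln (2 * cos \<theta>)) has_integral (3 * sqrt 3 / 4 * L_chi_m3 2)) {-pi/3..pi/3}"
proof -
  let ?f = "\<lambda>\<rho> \<theta>. ln (norm (1 + of_real \<rho> * cis (2 * \<theta>)))"
  let ?c = "\<lambda>n. sqrt 3 / 2 * ((-1) ^ Suc n * chi_m3 n / real n ^ 2)"
  \<comment> \<open>A zero would force \<open>\<rho> = 1\<close> and
    \<open>cos \<theta> = 0\<close>, which cannot occur for
    \<open>\<bar>\<theta>\<bar> \<le> pi / 3\<close>. Hence the integrand is jointly continuous up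
    to \<open>\<rho> = 1\<close>, and so is its integral in \<open>\<rho>\<close>.\<close>
  have nz: "1 + of_real \<rho> * cis (2 * \<theta>) \<noteq> 0" if "\<rho> \<in> {0..1}" "\<theta> \<in> {-pi/3..pi/3}" for \<rho> \<theta>
  proof
    assume 0: "1 + of_real \<rho> * cis (2 * \<theta>) = 0"
    then have "norm (of_real \<rho> * cis (2 * \<theta>)) = 1"
      by (simp only: add_eq_0_iff norm_minus_cancel norm_one)
    with that have [simp]: "\<rho> = 1" by (simp add: norm_mult)
    have "Re (1 + of_real \<rho> * cis (2 * \<theta>)) = 0" using 0 by simp
    then have "(cos \<theta>)\<^sup>2 = 0" by (simp add: cos_double_cos)
    moreover have "cos \<theta> > 0" using that pi_gt_zero unfolding atLeastAtMost_iff by (intro cos_gt_zero_pi) linarith+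
    ultimately show False by simp
  qed
  have cont: "continuous_on ({0..1} \<times> cbox (-pi/3) (pi/3)) (\<lambda>(\<rho>, \<theta>). ?f \<rho> \<theta>)"
    unfolding case_prod_beta using nz by (intro continuous_intros) auto
  then have "continuous_on {0..1} (\<lambda>\<rho>. integral (cbox (-pi/3) (pi/3)) (?f \<rho>))"
    by (rule integral_continuous_on_param)
  then have lim1: "((\<lambda>\<rho>. integral {-pi/3..pi/3} (?f \<rho>)) \<longlongrightarrow> integral {-pi/3..pi/3} (?f 1)) (at 1 within {0..1})"
    unfolding cbox_interval continuous_on_def by (elim ballE[of _ _ 1]) (assumption, simp)
  \<comment> \<open>The coefficients are absolutely summable, so the power series converges
    uniformly on \<open>{0..1}\<close> and its sum is continuous at 1.\<close>
  have "summable (\<lambda>n. sqrt 3 / 2 * \<bar>chi_m3 n / real n ^ 2\<bar>)"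
    by (intro summable_mult summable_chi_m3_over_square)
  then have "uniform_limit {0..1} (\<lambda>N \<rho>. \<Sum>n<N. \<rho> ^ n * ?c n) (\<lambda>\<rho>. \<Sum>n. \<rho> ^ n * ?c n) sequentially"
  proof (rule Weierstrass_m_test[rotated])
    fix n and \<rho> :: real assume "\<rho> \<in> {0..1}"
    then have "\<bar>\<rho> ^ n\<bar> * \<bar>?c n\<bar> \<le> 1 * \<bar>?c n\<bar>"
      by (intro mult_right_mono) (auto simp: power_le_one)
    then show "norm (\<rho> ^ n * ?c n) \<le> sqrt 3 / 2 * \<bar>chi_m3 n / real n ^ 2\<bar>"
      by (simp add: abs_mult)
  qed
  then have "continuous_on {0..1} (\<lambda>\<rho>::real. \<Sum>n. \<rho> ^ n * ?c n)"
    by (rule uniform_limit_theorem[rotated]) (simp, intro always_eventually allI continuous_intros)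
  then have lim2: "((\<lambda>\<rho>. \<Sum>n. \<rho> ^ n * ?c n) \<longlongrightarrow> (\<Sum>n. 1 ^ n * ?c n)) (at 1 within {0..1})"
    unfolding continuous_on_def by (elim ballE[of _ _ 1]) (assumption, simp)
  have "\<forall>\<^sub>F \<rho> in at 1 within {0..1}. (\<Sum>n. \<rho> ^ n * ?c n) = integral {-pi/3..pi/3} (?f \<rho>)"
    unfolding eventually_at_filter
    by (intro always_eventually allI impI sums_unique[symmetric] integral_ln_one_plus_rho_cis) auto
  with lim2 have "((\<lambda>\<rho>. integral {-pi/3..pi/3} (?f \<rho>)) \<longlongrightarrow> (\<Sum>n. 1 ^ n * ?c n)) (at 1 within {0..1})"
    by (rule Lim_transform_eventually)
  moreover have "at (1::real) within {0..1} \<noteq> bot"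
    by (simp add: trivial_limit_within islimpt_Icc)
  ultimately have "integral {-pi/3..pi/3} (?f 1) = (\<Sum>n. 1 ^ n * ?c n)"
    using lim1 by (intro tendsto_unique[of "at 1 within {0..1}"])
  also have "\<dots> = sqrt 3 / 2 * (3 / 2 * L_chi_m3 2)"
    using sums_mult[OF sums_alternating_chi_m3, of "sqrt 3 / 2"] by (simp add: sums_iff)
  finally have "integral {-pi/3..pi/3} (?f 1) = 3 * sqrt 3 / 4 * L_chi_m3 2" by simp
  moreover have "?f 1 integrable_on {-pi/3..pi/3}"
    using nz[of 1] by (intro integrable_continuous_real continuous_intros) auto
  ultimately have "(?f 1 has_integral (3 * sqrt 3 / 4 * L_chi_m3 2)) {-pi/3..pi/3}"
    by (simp only: has_integral_iff)
  then show ?thesis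
  proof (rule has_integral_eq[rotated])
    fix \<theta> assume "\<theta> \<in> {-pi/3..pi/3}"
    then have "cos \<theta> > 0" using pi_gt_zero unfolding atLeastAtMost_iff by (intro cos_gt_zero_pi) linarith+
    have "1 + cis (2 * \<theta>) = of_real (2 * cos \<theta>) * cis \<theta>"
      by (simp add: complex_eq_iff cos_double_cos sin_double power2_eq_square)
    then have "norm (1 + cis (2 * \<theta>)) = 2 * cos \<theta>"
      using \<open>cos \<theta> > 0\<close> by (simp add: norm_mult)
    then show "?f 1 \<theta> = ln (2 * cos \<theta>)" by simp
  qed
qed

section \<open>The double integral\<close>

text \<open>The constant 4 exceeds 3, the maximum of \<open>norm (1 + x + y)\<close> on the product
  of the disks. The case \<open>z = 0\<close> rests on \<open>ln 0 = 0\<close>.\<close>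

lemma ln_le_ln4:
  fixes z :: complex
  assumes "norm z \<le> 4"
  shows "ln (norm z) \<le> ln 4"
  using assms by (cases "z = 0") auto

lemma disk_log_mean_le_ln4: "0 \<le> s \<Longrightarrow> s \<le> 4 \<Longrightarrow> disk_log_mean s \<le> ln 4"
proof -
  assume "0 \<le> s" "s \<le> 4"
  moreover have "(s\<^sup>2 - 1) / 2 \<le> 0" if "s \<le> 1" using that \<open>0 \<le> s\<close> by (simp add: power_le_one)
  moreover have "ln (4::real) \<ge> 0" by simp
  ultimately show "disk_log_mean s \<le> ln 4"
    unfolding disk_log_mean_def by (smt (verit) ln_le_cancel_iff)
qed

text \<open>Folds signed radii: \<open>r\<close> and \<open>- r\<close> are paired as
  \<open>has_integral_ln_antipodal\<close> requires. The point 0, counted twice, is a null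
  set.\<close>

lemma nn_integral_symmetric_interval:
  fixes f :: "real \<Rightarrow> ennreal" and c :: real
  assumes [measurable]: "f \<in> borel_measurable borel"
  shows "(\<integral>\<^sup>+r. f r * indicator {-c..c} r \<partial>lborel) = (\<integral>\<^sup>+r. (f r + f (- r)) * indicator {0..c} r \<partial>lborel)"
proof -
  have "(\<integral>\<^sup>+r. f r * indicator {-c..c} r \<partial>lborel)
    = (\<integral>\<^sup>+r. f r * indicator {0..c} r + f r * indicator {0..c} (- r) \<partial>lborel)"
    using AE_lborel_singleton[of "0::real"]
    by (intro nn_integral_cong_AE) (auto elim!: eventually_mono split: split_indicator)
  also have "\<dots> = (\<integral>\<^sup>+r. f r * indicator {0..c} r \<partial>lborel) + (\<integral>\<^sup>+r. f r * indicator {0..c} (- r) \<partial>lborel)"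
    by (rule nn_integral_add) measurable
  also have "(\<integral>\<^sup>+r. f r * indicator {0..c} (- r) \<partial>lborel) = (\<integral>\<^sup>+r. f (- r) * indicator {0..c} r \<partial>lborel)"
    by (subst nn_integral_real_affine[where c = "-1" and t = 0]) auto
  also have "(\<integral>\<^sup>+r. f r * indicator {0..c} r \<partial>lborel) + \<dots> = (\<integral>\<^sup>+r. (f r + f (- r)) * indicator {0..c} r \<partial>lborel)"
    by (subst nn_integral_add[symmetric]) (auto simp: distrib_right)
  finally show ?thesis .
qed

text \<open>Subtracting from \<open>ln 4\<close> makes the integrand nonnegative, so that Tonelli's theorem applies.\<close>
lemma nn_integral_disk_ln:
  fixes a :: complex
  assumes a: "norm a \<le> 2"
  shows "(\<integral>\<^sup>+y. ennreal (ln 4 - ln (norm (a + y))) * indicator (cball 0 1) y \<partial>lborel) =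
    ennreal (pi * (ln 4 - disk_log_mean (norm a)))"
proof -
  have [measurable]: "cball 0 1 \<in> sets (borel :: complex measure)" by simp
  let ?J = "\<lambda>r. \<integral>\<^sup>+\<theta>. ennreal (ln 4 - ln (norm (a + of_real r * cis \<theta>))) * indicator {-pi/2<..<pi/2} \<theta> \<partial>lborel"
  \<comment> \<open>The excluded radius is that of the circle through the singularity
    \<open>- a\<close>; being a single value of \<open>r\<close>, it is discarded almost
    everywhere.\<close>
  have antipodal: "?J r + ?J (- r) = ennreal (2 * pi * (ln 4 - ln (max (norm a) r)))"
    if r: "0 \<le> r" "r \<le> 1" "r \<noteq> norm a" for r
  proof -
    let ?g = "\<lambda>\<theta>. ln (norm (a + of_real r * cis \<theta>)) + ln (norm (a - of_real r * cis \<theta>))"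
    have le: "norm (a + of_real r * cis \<theta>) \<le> 4" "norm (a - of_real r * cis \<theta>) \<le> 4" for \<theta>
      using norm_triangle_ineq[of a "of_real r * cis \<theta>"] norm_triangle_ineq4[of a "of_real r * cis \<theta>"] a r
      by (auto simp: norm_mult)
    have "?J r + ?J (- r) = (\<integral>\<^sup>+\<theta>. ennreal (2 * ln 4 - ?g \<theta>) * indicator {-pi/2<..<pi/2} \<theta> \<partial>lborel)"
      using ln_le_ln4[OF le(1)] ln_le_ln4[OF le(2)]
      by (subst nn_integral_add[symmetric])
        (auto simp: diff_diff_eq algebra_simps simp flip: distrib_right ennreal_plus
          intro!: nn_integral_cong split: split_indicator)
    also have "((\<lambda>\<theta>. 2 * ln 4 - ?g \<theta>) has_integral (2 * ln 4 * pi - 2 * pi * ln (max (norm a) r))) {-pi/2..pi/2}"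
      using has_integral_const_real[of "2 * ln 4 :: real" "-pi/2" "pi/2"] r
      by (intro has_integral_diff has_integral_ln_antipodal) (auto simp: mult_ac)
    then have "(\<integral>\<^sup>+\<theta>. ennreal (2 * ln 4 - ?g \<theta>) * indicator {-pi/2<..<pi/2} \<theta> \<partial>lborel) =
        ennreal (2 * ln 4 * pi - 2 * pi * ln (max (norm a) r))"
      using ln_le_ln4[OF le(1)] ln_le_ln4[OF le(2)] add_mono[OF ln_le_ln4[OF le(1)] ln_le_ln4[OF le(2)]]
      by (intro nn_integral_has_integral_lebesgue') (auto simp: has_integral_Icc_iff_Ioo)
    finally show ?thesis by (simp add: algebra_simps)
  qed
  have "(\<integral>\<^sup>+y. ennreal (ln 4 - ln (norm (a + y))) * indicator (cball 0 1) y \<partial>lborel) =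
    (\<integral>\<^sup>+\<theta>. \<integral>\<^sup>+r. ennreal \<bar>r\<bar> * (ennreal (ln 4 - ln (norm (a + of_real r * cis \<theta>))) * indicator (cball 0 1) (of_real r * cis \<theta>))
       * indicator {-pi/2<..<pi/2} \<theta> \<partial>lborel \<partial>lborel)"
    by (subst nn_integral_polar) (auto simp: nn_integral_multc)
  also have "\<dots> = (\<integral>\<^sup>+r. \<integral>\<^sup>+\<theta>. ennreal \<bar>r\<bar> * (ennreal (ln 4 - ln (norm (a + of_real r * cis \<theta>))) * indicator (cball 0 1) (of_real r * cis \<theta>))
       * indicator {-pi/2<..<pi/2} \<theta> \<partial>lborel \<partial>lborel)"
    \<comment> \<open>The angle is now integrated first, at fixed radius, so that Jensen's formula
      applies.\<close>
    by (rule lborel_pair.Fubini') measurable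
  also have "\<dots> = (\<integral>\<^sup>+r. (ennreal \<bar>r\<bar> * ?J r) * indicator {-1..1} r \<partial>lborel)"
  proof (rule nn_integral_cong)
    fix r :: real
    have "(\<integral>\<^sup>+\<theta>. ennreal \<bar>r\<bar> * (ennreal (ln 4 - ln (norm (a + of_real r * cis \<theta>))) * indicator (cball 0 1) (of_real r * cis \<theta>))
       * indicator {-pi/2<..<pi/2} \<theta> \<partial>lborel) =
      (\<integral>\<^sup>+\<theta>. (ennreal \<bar>r\<bar> * indicator {-1..1} r) * (ennreal (ln 4 - ln (norm (a + of_real r * cis \<theta>))) * indicator {-pi/2<..<pi/2} \<theta>) \<partial>lborel)"
      by (intro nn_integral_cong) (auto simp: norm_mult abs_le_iff split: split_indicator)
    also have "\<dots> = (ennreal \<bar>r\<bar> * indicator {-1..1} r) * ?J r"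
      by (rule nn_integral_cmult) measurable
    finally show "(\<integral>\<^sup>+\<theta>. ennreal \<bar>r\<bar> * (ennreal (ln 4 - ln (norm (a + of_real r * cis \<theta>))) * indicator (cball 0 1) (of_real r * cis \<theta>))
       * indicator {-pi/2<..<pi/2} \<theta> \<partial>lborel) = (ennreal \<bar>r\<bar> * ?J r) * indicator {-1..1} r"
      by (simp add: mult_ac)
  qed
  also have "\<dots> = (\<integral>\<^sup>+r. (ennreal \<bar>r\<bar> * ?J r + ennreal \<bar>- r\<bar> * ?J (- r)) * indicator {0..1} r \<partial>lborel)"
    by (rule nn_integral_symmetric_interval) measurable
  also have "\<dots> = (\<integral>\<^sup>+r. ennreal (2 * pi * (r * (ln 4 - ln (max (norm a) r)))) * indicator {0..1} r \<partial>lborel)"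
  proof (rule nn_integral_cong_AE)
    have "(ennreal \<bar>r\<bar> * ?J r + ennreal \<bar>- r\<bar> * ?J (- r)) * indicator {0..1} r =
       ennreal (2 * pi * (r * (ln 4 - ln (max (norm a) r)))) * indicator {0..1} r" if "r \<noteq> norm a" for r
    proof (cases "r \<in> {0..1}")
      case True
      then have "ennreal \<bar>r\<bar> * ?J r + ennreal \<bar>- r\<bar> * ?J (- r) = ennreal r * (?J r + ?J (- r))"
        by (simp add: distrib_left)
      also have "\<dots> = ennreal (r * (2 * pi * (ln 4 - ln (max (norm a) r))))"
        using True that by (subst antipodal) (auto simp: ennreal_mult')
      finally show ?thesis by (simp add: mult_ac)
    qed simp
    then show "AE r in lborel. (ennreal \<bar>r\<bar> * ?J r + ennreal \<bar>- r\<bar> * ?J (- r)) * indicator {0..1} r =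
       ennreal (2 * pi * (r * (ln 4 - ln (max (norm a) r)))) * indicator {0..1} r"
      using AE_lborel_singleton[of "norm a"] by (auto elim!: eventually_mono)
  qed
  also have "\<dots> = ennreal (2 * pi * ((ln 4 - disk_log_mean (norm a)) / 2))"
  proof (intro nn_integral_has_integral_lebesgue' has_integral_mult_right has_integral_radial_ln_max)
    fix r :: real assume "r \<in> {0..1}"
    moreover have "ln (max (norm a) r) \<le> ln 4"
      using a \<open>r \<in> {0..1}\<close> ln_le_ln4[of "of_real (max (norm a) r)"] by auto
    ultimately show "0 \<le> 2 * pi * (r * (ln 4 - ln (max (norm a) r)))" by auto
  qed simp
  finally show ?thesis by simp
qed

text \<open>The expression is the integral of the nonnegative
  \<open>r * (ln 4 - disk_log_mean r)\<close>, which avoids estimating the closed form.\<close>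

lemma radial_log_mean_nonneg:
  assumes "0 \<le> cos \<theta>"
  shows "0 \<le> ln 4 * (2 * cos \<theta>)\<^sup>2 / 2 - radial_log_mean (2 * cos \<theta>)"
proof (rule has_integral_nonneg[OF has_integral_radial_disk_log_mean])
  fix r assume "r \<in> {0..2 * cos \<theta>}"
  then have "0 \<le> r" "r \<le> 4" using cos_le_one[of \<theta>] unfolding atLeastAtMost_iff by linarith+
  then show "0 \<le> r * (ln 4 - disk_log_mean r)"
    using disk_log_mean_le_ln4[of r] by auto
qed (use assms in simp)

text \<open>Again the value of an integral with nonnegative integrand. It allows the final equation
  in \<open>ennreal\<close> to be read as one between reals.\<close>

lemma disk_log_double_integral_nonneg: "0 \<le> ln 4 * pi - pi / 6 + 11 * sqrt 3 / 16 - 3 * sqrt 3 / 4 * L_chi_m3 2"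
proof (rule has_integral_nonneg[OF has_integral_radial_log_mean[OF has_integral_ln_2_cos]])
  fix \<theta> assume "\<theta> \<in> {-pi/2..pi/2}"
  then show "0 \<le> ln 4 * (2 * cos \<theta>)\<^sup>2 / 2 - radial_log_mean (2 * cos \<theta>)"
    by (intro radial_log_mean_nonneg cos_ge_zero) auto
qed

text \<open>In signed polar coordinates the disk \<open>\<bar>a - 1\<bar> \<le> 1\<close> is \<open>0 \<le> r \<le> 2 cos \<theta>\<close>.\<close>
lemma nn_integral_disk_log_mean:
  "(\<integral>\<^sup>+x. ennreal (pi * (ln 4 - disk_log_mean (norm (1 + x)))) * indicator (cball 0 1) x \<partial>(lborel :: complex measure)) =
    ennreal (pi * (ln 4 * pi - pi / 6 + 11 * sqrt 3 / 16 - 3 * sqrt 3 / 4 * L_chi_m3 2))"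
proof -
  have [measurable]: "disk_log_mean \<in> borel_measurable borel"
    unfolding disk_log_mean_def[abs_def] by measurable
  \<comment> \<open>\<open>F\<close> is the integrand in the variable \<open>a = 1 + x\<close>, so
    the disk is centred at 1.\<close>
  define F where "F = (\<lambda>z :: complex. ennreal (pi * (ln 4 - disk_log_mean (norm z))) * indicator (cball 1 1) z)"
  have [measurable]: "cball 1 1 \<in> sets (borel :: complex measure)" by simp
  have [measurable]: "F \<in> borel_measurable borel"
    unfolding F_def by measurable
  have "(\<integral>\<^sup>+z. F z \<partial>lborel) = (\<integral>\<^sup>+x. F (1 + x) \<partial>lborel)"
    by (subst lborel_affine[of 1 1]) (simp_all add: density_1 nn_integral_distr)
  also have "\<dots> = (\<integral>\<^sup>+x. ennreal (pi * (ln 4 - disk_log_mean (norm (1 + x)))) * indicator (cball 0 1) x \<partial>(lborel :: complex measure))"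
    by (intro nn_integral_cong) (simp add: F_def indicator_def dist_norm)
  finally have "(\<integral>\<^sup>+x. ennreal (pi * (ln 4 - disk_log_mean (norm (1 + x)))) * indicator (cball 0 1) x \<partial>(lborel :: complex measure)) =
    (\<integral>\<^sup>+\<theta>. (\<integral>\<^sup>+r. ennreal \<bar>r\<bar> * F (of_real r * cis \<theta>) \<partial>lborel) * indicator {-pi/2<..<pi/2} \<theta> \<partial>lborel)"
    by (simp add: nn_integral_polar)
  also have "\<dots> = (\<integral>\<^sup>+\<theta>. ennreal (pi * (ln 4 * (2 * cos \<theta>)\<^sup>2 / 2 - radial_log_mean (2 * cos \<theta>))) * indicator {-pi/2<..<pi/2} \<theta> \<partial>lborel)"
  proof (rule nn_integral_cong)
    fix \<theta> :: real
    have "(\<integral>\<^sup>+r. ennreal \<bar>r\<bar> * F (of_real r * cis \<theta>) \<partial>lborel) =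
       ennreal (pi * (ln 4 * (2 * cos \<theta>)\<^sup>2 / 2 - radial_log_mean (2 * cos \<theta>)))" if "\<theta> \<in> {-pi/2<..<pi/2}"
    proof -
      have c: "cos \<theta> > 0" using that by (intro cos_gt_zero_pi) auto
      have mem: "of_real r * cis \<theta> \<in> cball 1 1 \<longleftrightarrow> r \<in> {0..2 * cos \<theta>}" for r
      proof -
        have "of_real r * cis \<theta> \<in> cball 1 1 \<longleftrightarrow> (norm (1 - of_real r * cis \<theta>))\<^sup>2 \<le> 1"
          by (simp add: dist_norm power_le_one_iff abs_square_le_1)
        also have "(norm (1 - of_real r * cis \<theta>))\<^sup>2 = 1 - 2 * r * cos \<theta> + r\<^sup>2"
          unfolding cmod_power2 by (simp add: power2_diff power_mult_distrib sin_squared_eq algebra_simps)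
        also have "\<dots> \<le> 1 \<longleftrightarrow> r * (2 * cos \<theta> - r) \<ge> 0"
          by (simp add: power2_eq_square algebra_simps)
        \<comment> \<open>As \<open>cos \<theta> > 0\<close>, a negative \<open>r\<close> makes the
          product negative, so only nonnegative radii contribute.\<close>
        also have "\<dots> \<longleftrightarrow> r \<in> {0..2 * cos \<theta>}"
          using c by (auto simp: zero_le_mult_iff)
        finally show ?thesis .
      qed
      have "(\<integral>\<^sup>+r. ennreal \<bar>r\<bar> * F (of_real r * cis \<theta>) \<partial>lborel) =
        (\<integral>\<^sup>+r. ennreal (pi * (r * (ln 4 - disk_log_mean r))) * indicator {0..2 * cos \<theta>} r \<partial>lborel)"
      proof (rule nn_integral_cong)
        fix r
        have ind: "indicator (cball 1 1) (of_real r * cis \<theta>) = (indicator {0..2 * cos \<theta>} r :: ennreal)"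
          by (simp only: indicator_def mem)
        show "ennreal \<bar>r\<bar> * F (of_real r * cis \<theta>) = ennreal (pi * (r * (ln 4 - disk_log_mean r))) * indicator {0..2 * cos \<theta>} r"
          unfolding F_def ind
          by (auto simp: norm_mult ennreal_mult'[symmetric] mult_ac split: split_indicator)
      qed
      also have "\<dots> = ennreal (pi * (ln 4 * (2 * cos \<theta>)\<^sup>2 / 2 - radial_log_mean (2 * cos \<theta>)))"
      proof (intro nn_integral_has_integral_lebesgue' has_integral_mult_right has_integral_radial_disk_log_mean)
        fix r assume "r \<in> {0..2 * cos \<theta>}"
        then have "0 \<le> r" "r \<le> 4"
          using cos_le_one[of \<theta>] unfolding atLeastAtMost_iff by linarith+
        then show "0 \<le> pi * (r * (ln 4 - disk_log_mean r))"
          using disk_log_mean_le_ln4[of r] by auto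
      qed (use c in simp)
      finally show ?thesis .
    qed
    then show "(\<integral>\<^sup>+r. ennreal \<bar>r\<bar> * F (of_real r * cis \<theta>) \<partial>lborel) * indicator {-pi/2<..<pi/2} \<theta> =
      ennreal (pi * (ln 4 * (2 * cos \<theta>)\<^sup>2 / 2 - radial_log_mean (2 * cos \<theta>))) * indicator {-pi/2<..<pi/2} \<theta>"
      by (auto split: split_indicator)
  qed
  also have "\<dots> = ennreal (pi * (ln 4 * pi - pi / 6 + 11 * sqrt 3 / 16 - 3 * sqrt 3 / 4 * L_chi_m3 2))"
  proof (rule nn_integral_has_integral_lebesgue')
    show "((\<lambda>\<theta>. pi * (ln 4 * (2 * cos \<theta>)\<^sup>2 / 2 - radial_log_mean (2 * cos \<theta>))) has_integral
        pi * (ln 4 * pi - pi / 6 + 11 * sqrt 3 / 16 - 3 * sqrt 3 / 4 * L_chi_m3 2)) {-pi/2<..<pi/2}"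
      unfolding has_integral_Icc_iff_Ioo[symmetric]
      by (intro has_integral_mult_right has_integral_radial_log_mean has_integral_ln_2_cos)
    show "0 \<le> pi * (ln 4 * (2 * cos \<theta>)\<^sup>2 / 2 - radial_log_mean (2 * cos \<theta>))" if "\<theta> \<in> {-pi/2<..<pi/2}" for \<theta>
      using that cos_gt_zero_pi[of \<theta>] by (intro mult_nonneg_nonneg radial_log_mean_nonneg) auto
  qed
  finally show ?thesis .
qed

theorem theorem1p1:
  shows "areal_mahler2 (\<lambda>x y. 1 + x + y) =
    3 * sqrt 3 / (4 * pi) * L_chi_m3 2 + 1 / 6 - 11 * sqrt 3 / (16 * pi)"
proof -
  \<comment> \<open>The value of the integral of \<open>ln 4 - ln (norm (1 + x + y))\<close> over
    the product of the disks.\<close>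
  define V where "V = pi * (ln 4 * pi - pi / 6 + 11 * sqrt 3 / 16 - 3 * sqrt 3 / 4 * L_chi_m3 2)"
  let ?D = "unit_disk \<times> unit_disk"
  let ?l = "\<lambda>z :: complex \<times> complex. ln (norm (1 + fst z + snd z))"
  let ?G = "\<lambda>z. indicator ?D z * (ln 4 - ?l z)"
  have [measurable]: "unit_disk \<in> sets borel" by (simp add: unit_disk_def)
  have [measurable]: "?D \<in> sets (borel \<Otimes>\<^sub>M borel)" by measurable
  have meas: "?G \<in> borel_measurable (lborel \<Otimes>\<^sub>M lborel)" "?G \<in> borel_measurable lborel"
    by (measurable, unfold borel_prod[symmetric] measurable_lborel2, measurable)
  have G_nonneg: "0 \<le> ?G z" for z
  proof (cases "z \<in> ?D")
    case True
    then have "norm (1 + fst z + snd z) \<le> 4"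
      using norm_triangle_ineq[of "1 + fst z" "snd z"] norm_triangle_ineq[of 1 "fst z"]
      by (auto simp: unit_disk_def)
    then show ?thesis using ln_le_ln4 by simp
  qed simp
  have "(\<integral>\<^sup>+z. ennreal (?G z) \<partial>lborel) = (\<integral>\<^sup>+z. ennreal (?G z) \<partial>(lborel \<Otimes>\<^sub>M lborel))"
    by (simp add: lborel_prod)
  also have "\<dots> = (\<integral>\<^sup>+x. \<integral>\<^sup>+y. ennreal (?G (x, y)) \<partial>lborel \<partial>lborel)"
    using meas(1) by (subst lborel.nn_integral_fst[symmetric]) auto
  also have "\<dots> = (\<integral>\<^sup>+x. ennreal (pi * (ln 4 - disk_log_mean (norm (1 + x)))) * indicator (cball 0 1) x \<partial>(lborel :: complex measure))"
  proof (rule nn_integral_cong)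
    fix x :: complex
    show "(\<integral>\<^sup>+y. ennreal (?G (x, y)) \<partial>lborel) = ennreal (pi * (ln 4 - disk_log_mean (norm (1 + x)))) * indicator (cball 0 1) x"
    proof (cases "norm x \<le> 1")
      case True
      have "(\<integral>\<^sup>+y. ennreal (?G (x, y)) \<partial>lborel) =
         (\<integral>\<^sup>+y. ennreal (ln 4 - ln (norm ((1 + x) + y))) * indicator (cball 0 1) y \<partial>lborel)"
        using True by (intro nn_integral_cong) (auto simp: unit_disk_def split: split_indicator)
      also have "\<dots> = ennreal (pi * (ln 4 - disk_log_mean (norm (1 + x))))"
        using True norm_triangle_ineq[of 1 x] by (intro nn_integral_disk_ln) auto
      finally show ?thesis using True by simp
    qed (simp add: unit_disk_def indicator_def)
  qed
  also have "\<dots> = ennreal V"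
    unfolding V_def by (rule nn_integral_disk_log_mean)
  finally have nn: "(\<integral>\<^sup>+z. ennreal (?G z) \<partial>lborel) = ennreal V" .
  have "0 \<le> V"
    unfolding V_def using disk_log_double_integral_nonneg by simp
  \<comment> \<open>A finite nonnegative integral gives integrability, including near the
    logarithmic singularity.\<close>
  with nn have G: "integrable lborel ?G" "integral\<^sup>L lborel ?G = V"
    using meas(2) G_nonneg by (auto simp: nn_integral_eq_integrable)
  have "emeasure lborel ?D = ennreal pi * ennreal pi"
    unfolding lborel_prod[symmetric]
    by (subst lborel.emeasure_pair_measure_Times) (auto simp: unit_disk_def emeasure_cball unit_ball_vol_2)
  then have D: "emeasure lborel ?D < \<infinity>" "measure lborel ?D = pi * pi"
    by (auto simp: measure_def ennreal_mult_less_top enn2real_mult)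
  \<comment> \<open>The shift by \<open>ln 4\<close> is undone: the constant contributes
    \<open>ln 4\<close> times the volume \<open>pi * pi\<close>, which cancels the same term in
    \<open>V\<close>.\<close>
  have "(\<integral>z \<in> ?D. ?l z \<partial>lborel) = integral\<^sup>L lborel (\<lambda>z. ln 4 * indicator ?D z - ?G z)"
    unfolding set_lebesgue_integral_def by (intro Bochner_Integration.integral_cong) (auto split: split_indicator)
  also have "\<dots> = ln 4 * (pi * pi) - V"
    using G D by (subst Bochner_Integration.integral_diff) (auto simp: borel_prod[symmetric])
  finally show ?thesis
    by (simp add: areal_mahler2_def V_def field_simps power2_eq_square)
qed

end
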